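(* (Well-balance of the modified TVB limiting process.) Let $C_1,C_2>0$ and let $h_h,m_h,w_h,\eta_h,b_h\in\mathcal V_h^k$ satisfy $$m_h=0,\qquad w_h=0,\qquad\eta_h=C_1h_h,\qquad h_h+b_h=C_2,$$ with the cell average $\bar h_{h,K}>0$ on every element $K\in\mathcal T_h$. Define $(b\theta)_h\in\mathcal V_h^k$ by $$(b\theta)_{h}|_K=\frac{\bar\eta_{h,K}}{\bar h_{h,K}}\,b_{h}|_K,\qquad\forall K\in\mathcal T_h,$$ where $\bar\eta_{h,K}$, $\bar h_{h,K}$ are the cell averages of $\eta_h,h_h$ on $K$. Let the TVB limiter $L$ (see context) be applied to $\big(h_h+b_h,\ m_h,\ w_h,\ \eta_h+(b\theta)_h\big)^T$, giving $\big((h_h+b_h)^{mod},m_h^{mod},w_h^{mod},(\eta_h+(b\theta)_h)^{mod}\big)^T$, and set $$h_h^{mod}=(h_h+b_h)^{mod}-b_h,\qquad\eta_h^{mod}=(\eta_h+(b\theta)_h)^{mod}-(b\theta)_h .$$ Then $$m_h^{mod}=0,\qquad w_h^{mod}=0,\qquad\eta_h^{mod}=C_1h_h^{mod},\qquad h_h^{mod}+b_h=C_2 .$$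
   Context: $\mathcal T_h$ is a triangular mesh of a domain $\Omega$, $k\ge1$ an integer, and $\mathcal V_h^k=\{q\in L^2(\Omega):q|_K\in\mathbb P^k(K)\ \forall K\in\mathcal T_h\}$, where $\mathbb P^k(K)$ is the set of polynomials of degree at most $k$ on $K$. The stated relations are the lake-at-rest steady state of the Ripa model, with $h$ the water depth, $m,w$ the momenta, $\eta=h\theta$ the depth times temperature, and $b$ the bottom topography. The characteristic-wise TVB limiter is regarded as an operator $L:(\mathcal V_h^k)^4\to(\mathcal V_h^k)^4$ that first checks in each cell whether limiting is needed and, if so, modifies the polynomials there; the property used is that it does not affect constants: if all four components of the input are constant functions on $\Omega$, then the output equals the input. *)

theory Defs
  imports "HOL-Analysis.Analysis"
begin

type_synonym pt = "real ^ 2"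

text \<open>A domain together with a conforming triangular mesh of it. The cells are the closed
  nondegenerate triangles. The requirement \<^term>\<open>interior K \<subseteq> \<Omega>\<close> excludes sets that merely share
  their closure with a polygonal domain, so that a property holds almost everywhere on \<open>\<Omega>\<close> iff it
  does so on every cell.\<close>

definition triangular_mesh :: "pt set \<Rightarrow> pt set set \<Rightarrow> bool" where
  "triangular_mesh \<Omega> \<T> \<longleftrightarrow>
     open \<Omega> \<and> connected \<Omega> \<and> \<Omega> \<noteq> {} \<and>
     triangulation \<T> \<and> (\<forall>K\<in>\<T>. 2 simplex K \<and> interior K \<subseteq> \<Omega>) \<and> \<Union>\<T> = closure \<Omega>"

definition poly_fun :: "nat \<Rightarrow> (pt \<Rightarrow> real) \<Rightarrow> bool" where
  "poly_fun k p \<longleftrightarrow>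
     (\<exists>c :: nat \<Rightarrow> nat \<Rightarrow> real. \<forall>x. p x = (\<Sum>i\<le>k. \<Sum>j\<le>k - i. c i j * (x $ 1) ^ i * (x $ 2) ^ j))"

text \<open>Elements of \<open>L\<^sup>2(S)\<close> are represented by functions on the whole plane whose values outside \<open>S\<close>
  are irrelevant; equality in \<open>L\<^sup>2(S)\<close> is \<open>ae_eq S\<close>.\<close>

definition L2_on :: "pt set \<Rightarrow> (pt \<Rightarrow> real) set" where
  "L2_on S = {q. q \<in> borel_measurable (lebesgue_on S) \<and> integrable (lebesgue_on S) (\<lambda>x. (q x)\<^sup>2)}"

definition ae_eq :: "pt set \<Rightarrow> (pt \<Rightarrow> real) \<Rightarrow> (pt \<Rightarrow> real) \<Rightarrow> bool" where
  "ae_eq S f g \<longleftrightarrow> (AE x in lebesgue_on S. f x = g x)"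

definition dg_space :: "pt set \<Rightarrow> pt set set \<Rightarrow> nat \<Rightarrow> (pt \<Rightarrow> real) set" where
  "dg_space \<Omega> \<T> k = {q \<in> L2_on \<Omega>. \<forall>K\<in>\<T>. \<exists>p. poly_fun k p \<and> ae_eq K q p}"

definition cell_average :: "pt set \<Rightarrow> (pt \<Rightarrow> real) \<Rightarrow> real" where
  "cell_average K q = (LINT x:K|lebesgue. q x) / measure lebesgue K"

type_synonym state = "(pt \<Rightarrow> real) \<times> (pt \<Rightarrow> real) \<times> (pt \<Rightarrow> real) \<times> (pt \<Rightarrow> real)"

definition dg_states :: "pt set \<Rightarrow> pt set set \<Rightarrow> nat \<Rightarrow> state set" where
  "dg_states \<Omega> \<T> k =
     dg_space \<Omega> \<T> k \<times> dg_space \<Omega> \<T> k \<times> dg_space \<Omega> \<T> k \<times> dg_space \<Omega> \<T> k"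

fun state_eq :: "pt set \<Rightarrow> state \<Rightarrow> state \<Rightarrow> bool" where
  "state_eq S (u1, u2, u3, u4) (v1, v2, v3, v4) \<longleftrightarrow>
     ae_eq S u1 v1 \<and> ae_eq S u2 v2 \<and> ae_eq S u3 v3 \<and> ae_eq S u4 v4"

text \<open>\<open>needs U K\<close> says that the check performed in cell \<open>K\<close> asks for limiting. The first three
  conditions make \<open>needs\<close> and \<open>L\<close> well defined on almost-everywhere classes; nothing is assumed
  about how the polynomials are modified in the cells to be limited.\<close>

definition cellwise_limiter ::
  "pt set \<Rightarrow> pt set set \<Rightarrow> nat \<Rightarrow> (state \<Rightarrow> pt set \<Rightarrow> bool) \<Rightarrow> (state \<Rightarrow> state) \<Rightarrow> bool" where
  "cellwise_limiter \<Omega> \<T> k needs L \<longleftrightarrow>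
     (\<forall>U \<in> dg_states \<Omega> \<T> k. L U \<in> dg_states \<Omega> \<T> k) \<and>
     (\<forall>U \<in> dg_states \<Omega> \<T> k. \<forall>V \<in> dg_states \<Omega> \<T> k. state_eq \<Omega> U V \<longrightarrow> state_eq \<Omega> (L U) (L V)) \<and>
     (\<forall>U \<in> dg_states \<Omega> \<T> k. \<forall>V \<in> dg_states \<Omega> \<T> k. \<forall>K \<in> \<T>.
        state_eq \<Omega> U V \<longrightarrow> needs U K = needs V K) \<and>
     (\<forall>U \<in> dg_states \<Omega> \<T> k. \<forall>K \<in> \<T>. \<not> needs U K \<longrightarrow> state_eq K (L U) U)"

definition preserves_constants ::
  "pt set \<Rightarrow> pt set set \<Rightarrow> nat \<Rightarrow> (state \<Rightarrow> state) \<Rightarrow> bool" where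
  "preserves_constants \<Omega> \<T> k L \<longleftrightarrow>
     (\<forall>U \<in> dg_states \<Omega> \<T> k. \<forall>c1 c2 c3 c4 :: real.
        state_eq \<Omega> U (\<lambda>_. c1, \<lambda>_. c2, \<lambda>_. c3, \<lambda>_. c4) \<longrightarrow> state_eq \<Omega> (L U) U)"

end

theory Submission
  imports Defs
begin

text \<open>
  The limiter sees the lake at rest as a constant state. The cell averages inherit the relation
  \<open>\<eta> = C1 * h\<close>, so the quotient of averages in the definition of \<open>b\<theta>\<close> is the same number \<open>C1\<close> in
  every cell (positivity of the averages of \<open>h\<close> allows the cancellation). Hence \<open>b\<theta> = C1 * b\<close> and
  \<open>\<eta> + b\<theta> = C1 * (h + b) = C1 * C2\<close> almost everywhere, while the other three limited variables are
  \<open>C2\<close>, \<open>0\<close> and \<open>0\<close>. The limiter leaves this state unchanged, and subtracting \<open>b\<close> and \<open>b\<theta>\<close>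
  gives back \<open>h\<close> and \<open>\<eta>\<close>.

  Two measure-theoretic points remain. Almost-everywhere statements must pass between the domain
  and the cells (\<open>ae_on_mesh_iff\<close>), because the steady state is given on the domain and \<open>b\<theta>\<close> cell by
  cell. And the limiter may only be applied to the four sums once these are known to belong to the
  discrete space (\<open>dg_space_add\<close>).
\<close>

section \<open>Almost-everywhere statements on a mesh\<close>

lemma ae_eq_iff_AE_lebesgue:
  assumes "S \<in> sets lebesgue"
  shows "ae_eq S f g \<longleftrightarrow> (AE x in lebesgue. x \<in> S \<longrightarrow> f x = g x)"
  unfolding ae_eq_def using assms by (simp add: AE_restrict_space_iff)

lemma mesh_cell_measurable:
  assumes "triangular_mesh \<Omega> \<T>" "K \<in> \<T>"
  shows "K \<in> sets lebesgue"
proof -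
  have "closed K"
    using assms closed_simplex by (auto simp: triangular_mesh_def)
  then show ?thesis by (simp add: lebesgue_closedin)
qed

text \<open>The domain is covered by the finitely many cells. Conversely, a cell need not lie in the
  domain, but only boundary points can stick out, and the boundary of a convex set is a null set.\<close>

lemma ae_on_mesh_iff:
  assumes mesh: "triangular_mesh \<Omega> \<T>"
  shows "ae_eq \<Omega> f g \<longleftrightarrow> (\<forall>K\<in>\<T>. ae_eq K f g)"
proof -
  have \<Omega>: "\<Omega> \<in> sets lebesgue"
    using mesh by (auto simp: triangular_mesh_def)
  have fin: "finite \<T>"
    using mesh by (simp add: triangular_mesh_def triangulation_def)
  have cover: "\<Omega> \<subseteq> \<Union>\<T>"
    using mesh closure_subset by (auto simp: triangular_mesh_def)
  show ?thesis
  proof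
    assume "ae_eq \<Omega> f g"
    then have ae: "AE x in lebesgue. x \<in> \<Omega> \<longrightarrow> f x = g x"
      using \<Omega> by (simp add: ae_eq_iff_AE_lebesgue)
    show "\<forall>K\<in>\<T>. ae_eq K f g"
    proof
      fix K assume K: "K \<in> \<T>"
      have smplx: "2 simplex K" and int: "interior K \<subseteq> \<Omega>"
        using mesh K by (auto simp: triangular_mesh_def)
      have "negligible (frontier K)"
        using smplx by (intro negligible_convex_frontier convex_simplex)
      then have "AE x in lebesgue. x \<notin> frontier K"
        by (intro AE_not_in) (simp add: negligible_iff_null_sets)
      then have "AE x in lebesgue. x \<in> K \<longrightarrow> f x = g x"
        using ae
      proof eventually_elim
        case (elim x)
        then show ?case
          using int closure_subset[of K] by (auto simp: frontier_def)
      qed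
      then show "ae_eq K f g"
        using mesh_cell_measurable[OF mesh K] by (simp add: ae_eq_iff_AE_lebesgue)
    qed
  next
    assume "\<forall>K\<in>\<T>. ae_eq K f g"
    then have "\<forall>K\<in>\<T>. AE x in lebesgue. x \<in> K \<longrightarrow> f x = g x"
      using mesh_cell_measurable[OF mesh] by (simp add: ae_eq_iff_AE_lebesgue)
    then have "AE x in lebesgue. \<forall>K\<in>\<T>. x \<in> K \<longrightarrow> f x = g x"
      by (simp only: AE_finite_all[OF fin])
    then have "AE x in lebesgue. x \<in> \<Omega> \<longrightarrow> f x = g x"
      by eventually_elim (use cover in blast)
    then show "ae_eq \<Omega> f g"
      using \<Omega> by (simp add: ae_eq_iff_AE_lebesgue)
  qed
qed

section \<open>Cell averages\<close>

text \<open>Lebesgue measure is complete, so two functions that agree almost everywhere are either both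
  measurable or both non-measurable; in the latter case both integrals have the default value \<open>0\<close>.\<close>

lemma lebesgue_integral_cong_ae:
  fixes f g :: "'a::euclidean_space \<Rightarrow> real"
  assumes ae: "AE x in lebesgue. f x = g x"
  shows "integral\<^sup>L lebesgue f = integral\<^sup>L lebesgue g"
proof (cases "f \<in> borel_measurable lebesgue")
  case True
  then show ?thesis
    using ae borel_measurable_AE by (intro integral_cong_AE) auto
next
  case False
  have "AE x in lebesgue. g x = f x"
    using ae by eventually_elim simp
  with False have "g \<notin> borel_measurable lebesgue"
    using borel_measurable_AE by blast
  with False have "\<not> integrable lebesgue f" "\<not> integrable lebesgue g"
    by auto
  then show ?thesis by (simp add: not_integrable_integral_eq)
qed

lemma cell_average_cong:
  assumes "K \<in> sets lebesgue" "ae_eq K f g"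
  shows "cell_average K f = cell_average K g"
proof -
  have "AE x in lebesgue. x \<in> K \<longrightarrow> f x = g x"
    using assms by (simp add: ae_eq_iff_AE_lebesgue)
  then have "AE x in lebesgue. indicator K x *\<^sub>R f x = indicator K x *\<^sub>R g x"
    by eventually_elim (auto simp: indicator_def)
  then show ?thesis
    unfolding cell_average_def set_lebesgue_integral_def
    by (simp only: lebesgue_integral_cong_ae)
qed

lemma cell_average_cmult: "cell_average K (\<lambda>x. c * f x) = c * cell_average K f"
  by (simp add: cell_average_def)

section \<open>The discrete space\<close>

lemma L2_on_add:
  assumes "f \<in> L2_on S" "g \<in> L2_on S"
  shows "(\<lambda>x. f x + g x) \<in> L2_on S"
proof -
  have meas [measurable]: "f \<in> borel_measurable (lebesgue_on S)"
      "g \<in> borel_measurable (lebesgue_on S)"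
    using assms by (auto simp: L2_on_def)
  have dom: "integrable (lebesgue_on S) (\<lambda>x. 2 * (f x)\<^sup>2 + 2 * (g x)\<^sup>2)"
    using assms by (auto simp: L2_on_def)
  have bound: "(a + b)\<^sup>2 \<le> 2 * a\<^sup>2 + 2 * b\<^sup>2" for a b :: real
    using zero_le_power2[of "a - b"] by (simp add: power2_eq_square algebra_simps)
  have "integrable (lebesgue_on S) (\<lambda>x. (f x + g x)\<^sup>2)"
    by (rule Bochner_Integration.integrable_bound[OF dom]) (use bound in auto)
  then show ?thesis by (simp add: L2_on_def)
qed

lemma poly_fun_add:
  assumes "poly_fun k p" "poly_fun k q"
  shows "poly_fun k (\<lambda>x. p x + q x)"
proof -
  obtain c d where
    "\<And>x. p x = (\<Sum>i\<le>k. \<Sum>j\<le>k - i. c i j * (x $ 1) ^ i * (x $ 2) ^ j)"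
    "\<And>x. q x = (\<Sum>i\<le>k. \<Sum>j\<le>k - i. d i j * (x $ 1) ^ i * (x $ 2) ^ j)"
    using assms by (auto simp: poly_fun_def)
  then show ?thesis
    unfolding poly_fun_def
    by (intro exI[of _ "\<lambda>i j. c i j + d i j"]) (simp add: sum.distrib algebra_simps)
qed

lemma dg_space_add:
  assumes f: "f \<in> dg_space \<Omega> \<T> k" and g: "g \<in> dg_space \<Omega> \<T> k"
  shows "(\<lambda>x. f x + g x) \<in> dg_space \<Omega> \<T> k"
proof -
  have "\<exists>r. poly_fun k r \<and> ae_eq K (\<lambda>x. f x + g x) r" if "K \<in> \<T>" for K
  proof -
    obtain p q where pq: "poly_fun k p" "ae_eq K f p" "poly_fun k q" "ae_eq K g q"
      using f g \<open>K \<in> \<T>\<close> unfolding dg_space_def by blast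
    have "ae_eq K (\<lambda>x. f x + g x) (\<lambda>x. p x + q x)"
      using pq(2,4) unfolding ae_eq_def by eventually_elim simp
    then show ?thesis using poly_fun_add[OF pq(1,3)] by blast
  qed
  then show ?thesis
    using f g by (auto simp: dg_space_def intro: L2_on_add)
qed

section \<open>Well-balance\<close>

text \<open>The cellwise factor \<open>cell_average K \<eta> / cell_average K h\<close> equals \<open>C\<close> in every cell, which is
  what makes \<open>b\<theta>\<close> a single multiple of \<open>b\<close> across the whole domain.\<close>

lemma ae_eq_cellwise_average_ratio:
  assumes mesh: "triangular_mesh \<Omega> \<T>"
    and \<eta>: "ae_eq \<Omega> \<eta> (\<lambda>x. C * h x)"
    and avg: "\<And>K. K \<in> \<T> \<Longrightarrow> cell_average K h \<noteq> 0"
    and b\<theta>: "\<And>K. K \<in> \<T> \<Longrightarrow> ae_eq K b\<theta> (\<lambda>x. cell_average K \<eta> / cell_average K h * b x)"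
  shows "ae_eq \<Omega> b\<theta> (\<lambda>x. C * b x)"
  unfolding ae_on_mesh_iff[OF mesh]
proof
  fix K assume K: "K \<in> \<T>"
  have "ae_eq K \<eta> (\<lambda>x. C * h x)"
    using \<eta> K ae_on_mesh_iff[OF mesh] by blast
  then have "cell_average K \<eta> = C * cell_average K h"
    using cell_average_cong[OF mesh_cell_measurable[OF mesh K]] cell_average_cmult by metis
  then have "cell_average K \<eta> / cell_average K h = C"
    using avg[OF K] by simp
  then show "ae_eq K b\<theta> (\<lambda>x. C * b x)"
    using b\<theta>[OF K] by simp
qed

theorem mainTheorem4:
  fixes \<Omega> :: "pt set" and \<T> :: "pt set set" and k :: nat
    and needs :: "state \<Rightarrow> pt set \<Rightarrow> bool" and L :: "state \<Rightarrow> state"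
    and C1 C2 :: real
    and h m w \<eta> b b\<theta> :: "pt \<Rightarrow> real"
    and hb_mod m_mod w_mod \<eta>b\<theta>_mod h_mod \<eta>_mod :: "pt \<Rightarrow> real"
  assumes mesh: "triangular_mesh \<Omega> \<T>"
    and k: "k \<ge> 1"
    and limiter: "cellwise_limiter \<Omega> \<T> k needs L"
    and const: "preserves_constants \<Omega> \<T> k L"
    and C_pos: "C1 > 0" "C2 > 0"
    and in_dg: "h \<in> dg_space \<Omega> \<T> k" "m \<in> dg_space \<Omega> \<T> k" "w \<in> dg_space \<Omega> \<T> k"
      "\<eta> \<in> dg_space \<Omega> \<T> k" "b \<in> dg_space \<Omega> \<T> k"
    and steady: "ae_eq \<Omega> m (\<lambda>x. 0)" "ae_eq \<Omega> w (\<lambda>x. 0)"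
      "ae_eq \<Omega> \<eta> (\<lambda>x. C1 * h x)" "ae_eq \<Omega> (\<lambda>x. h x + b x) (\<lambda>x. C2)"
    and avg_pos: "\<And>K. K \<in> \<T> \<Longrightarrow> cell_average K h > 0"
    and b\<theta>_dg: "b\<theta> \<in> dg_space \<Omega> \<T> k"
    and b\<theta>: "\<And>K. K \<in> \<T> \<Longrightarrow>
      ae_eq K b\<theta> (\<lambda>x. cell_average K \<eta> / cell_average K h * b x)"
    and limited: "(hb_mod, m_mod, w_mod, \<eta>b\<theta>_mod) =
      L (\<lambda>x. h x + b x, m, w, \<lambda>x. \<eta> x + b\<theta> x)"
    and h_mod: "h_mod = (\<lambda>x. hb_mod x - b x)"
    and \<eta>_mod: "\<eta>_mod = (\<lambda>x. \<eta>b\<theta>_mod x - b\<theta> x)"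
  shows "ae_eq \<Omega> m_mod (\<lambda>x. 0) \<and> ae_eq \<Omega> w_mod (\<lambda>x. 0) \<and>
    ae_eq \<Omega> \<eta>_mod (\<lambda>x. C1 * h_mod x) \<and> ae_eq \<Omega> (\<lambda>x. h_mod x + b x) (\<lambda>x. C2)"
proof -
  have b\<theta>_eq: "ae_eq \<Omega> b\<theta> (\<lambda>x. C1 * b x)"
    using ae_eq_cellwise_average_ratio[OF mesh steady(3) _ b\<theta>] avg_pos
    by (metis less_irrefl)
  have \<eta>b\<theta>_const: "ae_eq \<Omega> (\<lambda>x. \<eta> x + b\<theta> x) (\<lambda>x. C1 * C2)"
    using b\<theta>_eq steady(3,4) unfolding ae_eq_def
    by eventually_elim (metis distrib_left)
  let ?U = "(\<lambda>x. h x + b x, m, w, \<lambda>x. \<eta> x + b\<theta> x)"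
  have U_dg: "?U \<in> dg_states \<Omega> \<T> k"
    using in_dg b\<theta>_dg by (simp add: dg_states_def dg_space_add)
  have "state_eq \<Omega> ?U (\<lambda>_. C2, \<lambda>_. 0, \<lambda>_. 0, \<lambda>_. C1 * C2)"
    using steady \<eta>b\<theta>_const by simp
  then have "state_eq \<Omega> (L ?U) ?U"
    using const U_dg unfolding preserves_constants_def by blast
  then have unchanged: "ae_eq \<Omega> hb_mod (\<lambda>x. h x + b x)" "ae_eq \<Omega> m_mod m" "ae_eq \<Omega> w_mod w"
      "ae_eq \<Omega> \<eta>b\<theta>_mod (\<lambda>x. \<eta> x + b\<theta> x)"
    by (simp_all flip: limited)
  have "ae_eq \<Omega> m_mod (\<lambda>x. 0)"
    using unchanged(2) steady(1) unfolding ae_eq_def by eventually_elim simp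
  moreover have "ae_eq \<Omega> w_mod (\<lambda>x. 0)"
    using unchanged(3) steady(2) unfolding ae_eq_def by eventually_elim simp
  moreover have "ae_eq \<Omega> \<eta>_mod (\<lambda>x. C1 * h_mod x)"
    using unchanged(1,4) steady(3) unfolding ae_eq_def h_mod \<eta>_mod by eventually_elim simp
  moreover have "ae_eq \<Omega> (\<lambda>x. h_mod x + b x) (\<lambda>x. C2)"
    using unchanged(1) steady(4) unfolding ae_eq_def h_mod by eventually_elim simp
  ultimately show ?thesis by blast
qed

end
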